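(* Let $(x,y)\in\mathbb{R}^2$ and $r_1>r_2>0$. For $k=1,2$ let $\theta_k=\Theta(x,y,r_k)$ and suppose $(r_k,\theta_k)$ is a left turn-to-bearing path through $(x,y)$, i.e. $0<\theta_k<2\pi$ and $H_{r_k,\theta_k}(d_k)=(x,y)$ for some $d_k\ge r_k\theta_k$. Then $$L(x,y,\Theta(x,y,r_1),r_1)>L(x,y,\Theta(x,y,r_2),r_2).$$
   Context: $L(x,y,\theta,r)=r\theta+\big\|(x,y)-r(\sin\theta,\,1-\cos\theta)\big\|$ (Euclidean norm), the length of the turn-to-bearing path reaching $(x,y)$ with heading $\theta$ via a turn of radius $r$. For $r>0$, $0<\theta_c<2\pi$: $H_{r,\theta_c}(d)=(r\sin(d/r),\ r(1-\cos(d/r)))$ if $0\le d\le r\theta_c$ and $H_{r,\theta_c}(d)=((d-r\theta_c)\cos\theta_c+r\sin\theta_c,\ (d-r\theta_c)\sin\theta_c+r(1-\cos\theta_c))$ if $d>r\theta_c$ (start at origin, heading $+x$). $\mathrm{atan}$ has values in $(-\pi/2,\pi/2)$. $\Theta(x,y,r)=2\,\mathrm{atan}\!\Big(\dfrac{x-\sqrt{x^2-(2r-y)y}}{2r-y}\Big)+P(x,y,r)$ if $2r-y\ne0$; $2\,\mathrm{atan}(y/(2x))$ if $2r=y$, $x>0$; $\pi\,\mathrm{sign}(r)$ if $2r=y$, $x\le0$. $P(x,y,r)=0$ if $\big(0<r\land((0<x\land0<y)\lor(x\le0\land 2r<y))\big)\lor\big(r<0\land((x<0\land y<0)\lor y<2r)\big)$;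 $P=2\pi$ if $0<r\land((0\le x\land y<0)\lor(x<0\land y<2r))$; $P=-2\pi$ if $r<0\land((0\le x\land 0<y)\lor(x<0\land 2r<y))$. *)

theory Defs
  imports "HOL-Analysis.Analysis"
begin

text \<open>The norm on \<^typ>\<open>real \<times> real\<close> is the Euclidean one.\<close>

definition ttb_length :: "real \<Rightarrow> real \<Rightarrow> real \<Rightarrow> real \<Rightarrow> real" where
  "ttb_length x y \<theta> r = r * \<theta> + norm ((x, y) - r *\<^sub>R (sin \<theta>, 1 - cos \<theta>))"

text \<open>Starting at the origin with heading \<open>+x\<close>, turn left with radius \<open>r\<close> through the angle
  \<open>\<theta>\<close>, then go straight; \<open>d\<close> is the arc length. Only meaningful for \<open>r > 0\<close>,
  \<open>0 < \<theta> < 2 * pi\<close> and \<open>d \<ge> 0\<close>.\<close>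

definition ttb_path :: "real \<Rightarrow> real \<Rightarrow> real \<Rightarrow> real \<times> real" where
  "ttb_path r \<theta> d =
    (if d \<le> r * \<theta> then (r * sin (d / r), r * (1 - cos (d / r)))
     else ((d - r * \<theta>) * cos \<theta> + r * sin \<theta>,
           (d - r * \<theta>) * sin \<theta> + r * (1 - cos \<theta>)))"

text \<open>The three conditions below leave some triples uncovered; these get the value \<open>0\<close>, which for
  \<open>r > 0\<close>, \<open>x \<ge> 0\<close>, \<open>y = 0\<close> makes \<open>turn_angle\<close> below the angle \<open>0\<close> of the straight path.
  For \<open>r > 0\<close> the conditions are mutually exclusive; for \<open>r < 0\<close> the first and the last one
  overlap, and the earlier one takes precedence.\<close>

definition angle_offset :: "real \<Rightarrow> real \<Rightarrow> real \<Rightarrow> real" where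
  "angle_offset x y r =
    (if (0 < r \<and> ((0 < x \<and> 0 < y) \<or> (x \<le> 0 \<and> 2 * r < y))) \<or>
        (r < 0 \<and> ((x < 0 \<and> y < 0) \<or> y < 2 * r)) then 0
     else if 0 < r \<and> ((0 \<le> x \<and> y < 0) \<or> (x < 0 \<and> y < 2 * r)) then 2 * pi
     else if r < 0 \<and> ((0 \<le> x \<and> 0 < y) \<or> (x < 0 \<and> 2 * r < y)) then - 2 * pi
     else 0)"

text \<open>The radicand is negative exactly when \<open>(x, y)\<close> lies strictly inside the turning circle, of
  centre \<open>(0, r)\<close> and radius \<open>\<bar>r\<bar>\<close>. No turn-to-bearing path of radius \<open>r\<close> passes through such a
  point after its turn, and the value of \<open>turn_angle\<close> there is meaningless.\<close>

definition turn_angle :: "real \<Rightarrow> real \<Rightarrow> real \<Rightarrow> real" where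
  "turn_angle x y r =
    (if 2 * r - y \<noteq> 0
     then 2 * arctan ((x - sqrt (x\<^sup>2 - (2 * r - y) * y)) / (2 * r - y)) + angle_offset x y r
     else if x > 0 then 2 * arctan (y / (2 * x))
     else pi * sgn r)"

definition left_ttb_through :: "real \<Rightarrow> real \<Rightarrow> real \<Rightarrow> real \<Rightarrow> bool" where
  "left_ttb_through x y r \<theta> \<longleftrightarrow>
    0 < r \<and> 0 < \<theta> \<and> \<theta> < 2 * pi \<and> (\<exists>d \<ge> r * \<theta>. ttb_path r \<theta> d = (x, y))"

end

theory Submission
  imports Defs
begin

text \<open>Let \<open>s\<close> be the length of the straight part, so that the path ends in
  \<open>s (cos \<theta>, sin \<theta>) + r (sin \<theta>, 1 - cos \<theta>)\<close> and has length \<open>r \<theta> + s\<close>. Projecting the two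
  representations of the common end point on the direction \<open>\<theta>\<^sub>2\<close> gives, with \<open>\<delta> = \<theta>\<^sub>1 - \<theta>\<^sub>2\<close>,
  the identity
  \<open>L\<^sub>1 - L\<^sub>2 = (r\<^sub>1 - r\<^sub>2) (\<theta>\<^sub>2 - sin \<theta>\<^sub>2) + r\<^sub>1 (\<delta> - sin \<delta>) + s\<^sub>1 (1 - cos \<delta>)\<close>,
  so it suffices that \<open>\<delta> \<ge> 0\<close>. Projecting on the normal of the direction \<open>\<theta>\<^sub>1\<close> gives \<open>sin \<delta> > 0\<close>,
  which leaves only \<open>\<delta> < -\<pi>\<close> to be excluded. In that case \<open>\<theta>\<^sub>1 < \<pi> < \<theta>\<^sub>2\<close> and \<open>y > 0\<close>, so
  \<open>x + s = y cot (\<theta> / 2)\<close> gives \<open>s\<^sub>1 > s\<^sub>2\<close>, whereas \<open>s\<^sup>2 = x\<^sup>2 + y\<^sup>2 - 2 r y\<close> gives \<open>s\<^sub>1 < s\<^sub>2\<close>.\<close>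

lemma left_ttb_through_obtain:
  assumes "left_ttb_through x y r \<theta>"
  obtains s where "s \<ge> 0" "x = s * cos \<theta> + r * sin \<theta>" "y = s * sin \<theta> + r * (1 - cos \<theta>)"
    "ttb_length x y \<theta> r = r * \<theta> + s"
proof -
  obtain d where d: "d \<ge> r * \<theta>" "ttb_path r \<theta> d = (x, y)" and r: "r > 0"
    using assms unfolding left_ttb_through_def by blast
  define s where "s = d - r * \<theta>"
  have s: "s \<ge> 0" using d(1) by (simp add: s_def)
  have xy: "x = s * cos \<theta> + r * sin \<theta> \<and> y = s * sin \<theta> + r * (1 - cos \<theta>)"
  \<comment> \<open>At \<open>d = r * \<theta>\<close> the arc branch of \<open>ttb_path\<close>
    applies; it agrees with the straight one for \<open>s = 0\<close>.\<close>
  proof (cases "d = r * \<theta>")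
    case True
    then show ?thesis using d(2) r by (auto simp: ttb_path_def s_def)
  next
    case False
    then show ?thesis using d by (auto simp: ttb_path_def s_def)
  qed
  then have "(x, y) - r *\<^sub>R (sin \<theta>, 1 - cos \<theta>) = s *\<^sub>R (cos \<theta>, sin \<theta>)"
    by simp
  moreover have "norm (cos \<theta>, sin \<theta>) = 1"
    by (simp add: norm_Pair)
  ultimately have "ttb_length x y \<theta> r = r * \<theta> + s"
    using s by (simp add: ttb_length_def del: scaleR_Pair diff_Pair)
  with s xy show thesis using that by blast
qed

text \<open>For small \<open>t\<close>, strictness comes from the factor
  \<open>cos (t / 2) < 1\<close> in the double-angle formula.\<close>

lemma sin_less_self:
  fixes t :: real
  assumes "t > 0"
  shows "sin t < t"
proof (cases "t \<le> 1")
  case True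
  then have t: "0 < t / 2" "t / 2 < pi" using assms pi_gt3 by auto
  then have "sin t < 2 * sin (t / 2)"
    using sin_double[of "t / 2"] cos_monotone_0_pi[of 0 "t / 2"] sin_gt_zero[of "t / 2"] by simp
  also have "\<dots> \<le> t" using sin_x_le_x[of "t / 2"] t by simp
  finally show ?thesis .
next
  case False
  then show ?thesis using sin_le_one[of t] by linarith
qed

text \<open>With \<open>a = \<theta> / 2\<close>, \<open>x + s\<close> and \<open>y\<close> are
  \<open>2 * cos a\<close> and \<open>2 * sin a\<close> times the common factor
  \<open>s * cos a + r * sin a\<close>.\<close>

lemma ttb_endpoint_half_angle:
  fixes s r \<theta> :: real
  defines "x \<equiv> s * cos \<theta> + r * sin \<theta>" and "y \<equiv> s * sin \<theta> + r * (1 - cos \<theta>)"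
  shows "(x + s) * sin (\<theta> / 2) = y * cos (\<theta> / 2)"
proof -
  define a where "a = \<theta> / 2"
  have \<theta>: "\<theta> = 2 * a" by (simp add: a_def)
  have "sin a * sin a = 1 - cos a * cos a"
    using sin_cos_squared_add[of a] by (simp add: power2_eq_square)
  then show ?thesis
    unfolding x_def y_def \<theta> cos_double sin_double power2_eq_square
    by simp algebra
qed

text \<open>Pythagoras: the centre \<open>(0, r)\<close>, the point where the turn ends and
  \<open>(x, y)\<close> form a right triangle with legs \<open>r\<close> and
  \<open>s\<close>.\<close>

lemma ttb_endpoint_norm:
  fixes s r \<theta> :: real
  defines "x \<equiv> s * cos \<theta> + r * sin \<theta>" and "y \<equiv> s * sin \<theta> + r * (1 - cos \<theta>)"
  shows "s\<^sup>2 = x\<^sup>2 + y\<^sup>2 - 2 * r * y"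
proof -
  have "(sin \<theta>)\<^sup>2 + (cos \<theta>)\<^sup>2 = 1" by simp
  then show ?thesis unfolding x_def y_def by algebra
qed

lemma ttb_angle_mono:
  fixes x y r\<^sub>1 r\<^sub>2 s\<^sub>1 s\<^sub>2 \<theta>\<^sub>1 \<theta>\<^sub>2 :: real
  assumes r: "r\<^sub>1 > r\<^sub>2" "r\<^sub>2 > 0" and s: "s\<^sub>1 \<ge> 0" "s\<^sub>2 \<ge> 0"
    and \<theta>: "0 < \<theta>\<^sub>1" "\<theta>\<^sub>1 < 2 * pi" "\<theta>\<^sub>2 < 2 * pi"
    and 1: "x = s\<^sub>1 * cos \<theta>\<^sub>1 + r\<^sub>1 * sin \<theta>\<^sub>1" "y = s\<^sub>1 * sin \<theta>\<^sub>1 + r\<^sub>1 * (1 - cos \<theta>\<^sub>1)"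
    and 2: "x = s\<^sub>2 * cos \<theta>\<^sub>2 + r\<^sub>2 * sin \<theta>\<^sub>2" "y = s\<^sub>2 * sin \<theta>\<^sub>2 + r\<^sub>2 * (1 - cos \<theta>\<^sub>2)"
  shows "\<theta>\<^sub>2 \<le> \<theta>\<^sub>1"
proof (rule ccontr)
  assume "\<not> \<theta>\<^sub>2 \<le> \<theta>\<^sub>1"
  then have less: "\<theta>\<^sub>1 < \<theta>\<^sub>2" by simp
  have "cos \<theta>\<^sub>1 \<noteq> 1"
  proof
    assume "cos \<theta>\<^sub>1 = 1"
    then obtain n :: int where "\<theta>\<^sub>1 = n * 2 * pi" by (auto simp: cos_one_2pi_int)
    moreover from this have "0 < n" "n < 1" using \<theta> by (auto simp: zero_less_mult_iff)
    ultimately show False by simp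
  qed
  then have "(r\<^sub>1 - r\<^sub>2) * (1 - cos \<theta>\<^sub>1) > 0"
    using r cos_le_one[of \<theta>\<^sub>1] by (simp add: less_le)
  moreover have "r\<^sub>2 * (1 - cos (\<theta>\<^sub>2 - \<theta>\<^sub>1)) \<ge> 0"
    using r by simp
  \<comment> \<open>Pairing both forms of \<open>(x, y)\<close> with
    \<open>(- sin \<theta>\<^sub>1, cos \<theta>\<^sub>1)\<close> eliminates
    \<open>s\<^sub>1\<close>.\<close>
  moreover have "s\<^sub>2 * sin (\<theta>\<^sub>2 - \<theta>\<^sub>1)
    = - r\<^sub>2 * (1 - cos (\<theta>\<^sub>2 - \<theta>\<^sub>1)) - (r\<^sub>1 - r\<^sub>2) * (1 - cos \<theta>\<^sub>1)"
  proof -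
    have "(sin \<theta>\<^sub>1)\<^sup>2 + (cos \<theta>\<^sub>1)\<^sup>2 = 1" by simp
    then show ?thesis using 1 2 unfolding sin_diff cos_diff by algebra
  qed
  ultimately have "s\<^sub>2 * sin (\<theta>\<^sub>2 - \<theta>\<^sub>1) < 0" by simp
  then have "sin (\<theta>\<^sub>2 - \<theta>\<^sub>1) < 0"
    using s(2) by (simp add: mult_less_0_iff)
  then have gap: "\<theta>\<^sub>2 - \<theta>\<^sub>1 > pi"
    using sin_ge_zero[of "\<theta>\<^sub>2 - \<theta>\<^sub>1"] less by linarith
  have "sin \<theta>\<^sub>1 > 0" using \<theta> gap by (intro sin_gt_zero) auto
  then have y: "y > 0"
    using 1(2) r s \<open>(r\<^sub>1 - r\<^sub>2) * (1 - cos \<theta>\<^sub>1) > 0\<close>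
    by (auto simp: zero_less_mult_iff intro!: add_nonneg_pos)
  have "s\<^sub>1\<^sup>2 = s\<^sub>2\<^sup>2 - 2 * (r\<^sub>1 - r\<^sub>2) * y"
    using ttb_endpoint_norm[of s\<^sub>1 \<theta>\<^sub>1 r\<^sub>1, folded 1] ttb_endpoint_norm[of s\<^sub>2 \<theta>\<^sub>2 r\<^sub>2, folded 2]
    by (simp add: algebra_simps)
  moreover have "(r\<^sub>1 - r\<^sub>2) * y > 0" using r y by simp
  ultimately have "s\<^sub>1\<^sup>2 < s\<^sub>2\<^sup>2" by linarith
  then have "s\<^sub>1 < s\<^sub>2" using s(2) by (rule power2_less_imp_less)
  \<comment> \<open>The half angles lie on either side of \<open>pi / 2\<close>, so their cosines,
    and with them \<open>x + s\<^sub>1\<close> and \<open>x + s\<^sub>2\<close>, have opposite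
    signs.\<close>
  have "(x + s\<^sub>1) * sin (\<theta>\<^sub>1 / 2) > 0"
    using ttb_endpoint_half_angle[of s\<^sub>1 \<theta>\<^sub>1 r\<^sub>1, folded 1] y \<theta> gap
      cos_gt_zero_pi[of "\<theta>\<^sub>1 / 2"] by simp
  moreover have "sin (\<theta>\<^sub>1 / 2) > 0" "sin (\<theta>\<^sub>2 / 2) > 0"
    using \<theta> gap less by (auto intro!: sin_gt_zero)
  ultimately have "x + s\<^sub>1 > 0" by (simp add: zero_less_mult_iff)
  moreover have "cos (\<theta>\<^sub>2 / 2) < 0"
    using cos_monotone_0_pi[of "pi / 2" "\<theta>\<^sub>2 / 2"] \<theta> gap by simp
  then have "(x + s\<^sub>2) * sin (\<theta>\<^sub>2 / 2) < 0"
    using ttb_endpoint_half_angle[of s\<^sub>2 \<theta>\<^sub>2 r\<^sub>2, folded 2] y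
    by (simp add: mult_pos_neg)
  then have "x + s\<^sub>2 < 0" using \<open>sin (\<theta>\<^sub>2 / 2) > 0\<close> by (simp add: mult_less_0_iff)
  ultimately show False using \<open>s\<^sub>1 < s\<^sub>2\<close> by simp
qed

theorem theorem8:
  fixes x y r\<^sub>1 r\<^sub>2 :: real
  assumes "r\<^sub>1 > r\<^sub>2" and "r\<^sub>2 > 0"
    and "left_ttb_through x y r\<^sub>1 (turn_angle x y r\<^sub>1)"
    and "left_ttb_through x y r\<^sub>2 (turn_angle x y r\<^sub>2)"
  shows "ttb_length x y (turn_angle x y r\<^sub>1) r\<^sub>1 > ttb_length x y (turn_angle x y r\<^sub>2) r\<^sub>2"
proof -
  define \<theta>\<^sub>1 where "\<theta>\<^sub>1 = turn_angle x y r\<^sub>1"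
  define \<theta>\<^sub>2 where "\<theta>\<^sub>2 = turn_angle x y r\<^sub>2"
  note paths = assms(3,4)[folded \<theta>\<^sub>1_def \<theta>\<^sub>2_def]
  obtain s\<^sub>1 where 1: "s\<^sub>1 \<ge> 0" "x = s\<^sub>1 * cos \<theta>\<^sub>1 + r\<^sub>1 * sin \<theta>\<^sub>1"
    "y = s\<^sub>1 * sin \<theta>\<^sub>1 + r\<^sub>1 * (1 - cos \<theta>\<^sub>1)" "ttb_length x y \<theta>\<^sub>1 r\<^sub>1 = r\<^sub>1 * \<theta>\<^sub>1 + s\<^sub>1"
    by (rule left_ttb_through_obtain[OF paths(1)])
  obtain s\<^sub>2 where 2: "s\<^sub>2 \<ge> 0" "x = s\<^sub>2 * cos \<theta>\<^sub>2 + r\<^sub>2 * sin \<theta>\<^sub>2"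
    "y = s\<^sub>2 * sin \<theta>\<^sub>2 + r\<^sub>2 * (1 - cos \<theta>\<^sub>2)" "ttb_length x y \<theta>\<^sub>2 r\<^sub>2 = r\<^sub>2 * \<theta>\<^sub>2 + s\<^sub>2"
    by (rule left_ttb_through_obtain[OF paths(2)])
  have \<theta>: "0 < \<theta>\<^sub>1" "\<theta>\<^sub>1 < 2 * pi" "0 < \<theta>\<^sub>2" "\<theta>\<^sub>2 < 2 * pi"
    using paths by (auto simp: left_ttb_through_def)
  define \<delta> where "\<delta> = \<theta>\<^sub>1 - \<theta>\<^sub>2"
  have "\<theta>\<^sub>2 \<le> \<theta>\<^sub>1"
    using ttb_angle_mono[OF assms(1,2) 1(1) 2(1) \<theta>(1,2,4) 1(2,3) 2(2,3)] .
  then have "r\<^sub>1 * (\<delta> - sin \<delta>) \<ge> 0"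
    using assms(1,2) sin_x_le_x[of \<delta>] by (simp add: \<delta>_def)
  moreover have "s\<^sub>1 * (1 - cos \<delta>) \<ge> 0" using 1(1) by simp
  \<comment> \<open>Strictness of the conclusion is drawn from this summand.\<close>
  moreover have "(r\<^sub>1 - r\<^sub>2) * (\<theta>\<^sub>2 - sin \<theta>\<^sub>2) > 0"
    using assms(1) sin_less_self[OF \<theta>(3)] by simp
  \<comment> \<open>The projection yields \<open>s\<^sub>2 = s\<^sub>1 * cos \<delta> + r\<^sub>1 *
    sin \<delta> + (r\<^sub>1 - r\<^sub>2) * sin \<theta>\<^sub>2\<close>.\<close>
  moreover have "(r\<^sub>1 * \<theta>\<^sub>1 + s\<^sub>1) - (r\<^sub>2 * \<theta>\<^sub>2 + s\<^sub>2)
    = (r\<^sub>1 - r\<^sub>2) * (\<theta>\<^sub>2 - sin \<theta>\<^sub>2) + r\<^sub>1 * (\<delta> - sin \<delta>) + s\<^sub>1 * (1 - cos \<delta>)"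
  proof -
    have "(sin \<theta>\<^sub>2)\<^sup>2 + (cos \<theta>\<^sub>2)\<^sup>2 = 1" by simp
    then show ?thesis using 1(2,3) 2(2,3) unfolding \<delta>_def sin_diff cos_diff by algebra
  qed
  ultimately show ?thesis
    using 1(4) 2(4) unfolding \<theta>\<^sub>1_def \<theta>\<^sub>2_def by linarith
qed

end
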